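(* Let $f : \mathbb{C} \to \mathbb{C}$ be an entire function satisfying $$\underline{\tau} := \liminf_{r \to \infty} \frac{\log \max_{|z| = r} |f(z)|}{r^2} < \infty.$$ Let $\Lambda = \{\lambda_j\}_{j=1}^\infty \subset \mathbb{C}$ be a uniformly discrete set with lower Beurling density $D^{-}(\Lambda) > 2\underline{\tau}/\pi$ such that $$\kappa := \limsup_{j \to \infty} \frac{\log |f(\lambda_j)|}{H(|\lambda_j|)} < \infty,$$ where $H : (0,\infty) \to (0,\infty)$ is non-decreasing and unbounded at infinity and such that $r^{-2}H(r)$ is non-increasing and tends to zero as $r \to \infty$. Then, $$\limsup_{r \to \infty} \frac{\log \max_{|z| = r} |f(z)|}{H(r)} \leq \kappa.$$
   Context: The convention $\log 0 = -\infty$ is used. A (countably infinite) set $\Lambda = \{\lambda_j\}_{j=1}^\infty \subset \mathbb{C}$ (with the $\lambda_j$ pairwise distinct) is uniformly discrete if $\inf_{j \neq k} |\lambda_j - \lambda_k| > 0$. Its lower Beurling density is $$D^{-}(\Lambda) := \liminf_{r \to \infty} \frac{\inf_{z_0 \in \mathbb{C}} |\Lambda \cap (rK + z_0)|}{r^2},$$ where $|\cdot|$ denotes cardinality and $K \subset \mathbb{C}$ is a fixed compact set of unit measure; the definition does not depend on the choice of $K$, and one may take $K = [-1/2,1/2] + \mathrm{i}[-1/2,1/2]$. *)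

theory Defs
  imports "HOL-Analysis.Analysis"
begin

(* The library's ln sends 0 to 0; this one follows the convention log 0 = -infinity. *)
definition elog :: "real \<Rightarrow> ereal" where
  "elog x = (if x = 0 then -\<infinity> else ereal (ln x))"

(* For r >= 0 and f continuous the supremum is attained, since the circle is compact and nonempty. *)
definition max_modulus :: "(complex \<Rightarrow> complex) \<Rightarrow> real \<Rightarrow> real" where
  "max_modulus f r = (SUP z\<in>sphere 0 r. norm (f z))"

definition unit_square :: "complex set" where
  "unit_square = {z. \<bar>Re z\<bar> \<le> 1/2 \<and> \<bar>Im z\<bar> \<le> 1/2}"

(* Points are counted with counting measure, so that an infinite set has cardinality infinity
   (card would give 0). *)
definition lower_Beurling_density :: "complex set \<Rightarrow> ereal" where
  "lower_Beurling_density \<Lambda> =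
     Liminf at_top (\<lambda>r::real.
       (INF z0. enn2ereal (emeasure (count_space UNIV)
          (\<Lambda> \<inter> (\<lambda>w. complex_of_real r * w + z0) ` unit_square))) / ereal (r\<^sup>2))"

end

theory Submission
  imports Defs "HOL-Complex_Analysis.Conformal_Mappings"
begin

text \<open>
  Choose \<open>a\<close> strictly between \<open>\<tau>\<close> and \<open>\<pi> D\<^sup>-/2\<close>. Dividing out a Blaschke product over the points of
  \<open>\<Lambda>\<close> in a disc of large fixed radius \<open>R\<close> about \<open>z\<close> bounds \<open>|g(z)|\<close> by \<open>C\<close> times the maximum of \<open>|g|\<close> on these
  points plus \<open>exp(-b R\<^sup>2)\<close> times its maximum on the bounding circle, with some \<open>b > a\<close>: this is Jensen's
  formula and the fact that, for each \<open>D < D\<^sup>-\<close>, every disc of large radius \<open>t\<close> contains at least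
  \<open>D \<pi> t\<^sup>2\<close> points. Applied to
  \<open>f\<close> times a suitable exponential, it shows that \<open>|f(w)| exp(-a |w - z\<^sub>0|\<^sup>2)\<close> can only have a large maximum
  over \<open>|w| \<le> r\<close> near the boundary, where it is tiny for the radii \<open>r\<close> realising the lower type. Hence \<open>|f(z\<^sub>0)|\<close>
  is at most a constant, independent of \<open>z\<^sub>0\<close>, times the supremum of
  \<open>|f(\<lambda>)| exp(-a |\<lambda> - z\<^sub>0|\<^sup>2)\<close> over \<open>\<Lambda>\<close>. Since \<open>H(r + s) \<le> H(r) (1 + s/r)\<^sup>2\<close> and \<open>H(r) = o(r\<^sup>2)\<close>,
  completing the square in \<open>s = |\<lambda> - z\<^sub>0|\<close> gives the claim.
\<close>

section \<open>Blaschke division and the discrete logarithm\<close>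

lemma entire_max_sphere:
  assumes "f holomorphic_on UNIV" "\<And>w. norm w = R \<Longrightarrow> norm (f w) \<le> B" "norm z \<le> R"
  shows "norm (f z :: complex) \<le> B"
proof (cases "R = 0")
  case True
  then show ?thesis using assms by simp
next
  case False
  show ?thesis
  proof (rule maximum_modulus_frontier[of f "cball 0 R"])
    show "f holomorphic_on interior (cball 0 R)"
      using assms(1) holomorphic_on_subset by blast
    show "continuous_on (closure (cball 0 R)) f"
      using assms(1) holomorphic_on_imp_continuous_on holomorphic_on_subset by blast
  qed (use assms False in auto)
qed

text \<open>Stated existentially because only the independence of \<open>C\<close> from \<open>S\<close>, \<open>f\<close>, \<open>M\<close> and \<open>m\<close> matters. The
  induction replaces \<open>f\<close> by \<open>(f - f(l))/b\<^sub>l\<close>, where \<open>b\<^sub>l\<close> is the Blaschke factor of \<open>l \<in> S\<close>; this is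
  again entire.\<close>

lemma finite_blaschke_estimate:
  fixes \<delta> R :: real
  assumes \<delta>: "\<delta> > 0" and R: "R > 0"
  shows "\<exists>C\<ge>0. \<forall>S f M m. finite S \<longrightarrow> card S \<le> n \<longrightarrow> S \<subseteq> ball 0 R \<longrightarrow>
      (\<forall>x\<in>S. \<forall>y\<in>S. x \<noteq> y \<longrightarrow> \<delta> \<le> dist x y) \<longrightarrow> f holomorphic_on UNIV \<longrightarrow>
      (\<forall>w. norm w = R \<longrightarrow> norm (f w) \<le> M) \<longrightarrow> (\<forall>w\<in>S. norm (f w) \<le> m) \<longrightarrow> 0 \<le> m \<longrightarrow>
      norm (f 0 :: complex) \<le> (\<Prod>x\<in>S. norm x / R) * M + C * m"
proof (induction n)
  case 0
  show ?case
  proof (intro exI[of _ 0] conjI allI impI)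
    fix S :: "complex set" and f :: "complex \<Rightarrow> complex" and M m :: real
    assume "finite S" "card S \<le> 0" "f holomorphic_on UNIV" "\<forall>w. norm w = R \<longrightarrow> norm (f w) \<le> M"
    then show "norm (f 0) \<le> (\<Prod>x\<in>S. norm x / R) * M + 0 * m"
      using entire_max_sphere[of f R M 0] R by simp
  qed simp
next
  case (Suc n)
  then obtain C where C0: "C \<ge> 0" and C: "\<And>S f M m. \<lbrakk>finite S; card S \<le> n; S \<subseteq> ball 0 R;
      \<forall>x\<in>S. \<forall>y\<in>S. x \<noteq> y \<longrightarrow> \<delta> \<le> dist x y; f holomorphic_on UNIV;
      \<forall>w. norm w = R \<longrightarrow> norm (f w) \<le> M; \<forall>w\<in>S. norm (f w) \<le> m; 0 \<le> m\<rbrakk> \<Longrightarrow>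
      norm (f 0 :: complex) \<le> (\<Prod>x\<in>S. norm x / R) * M + C * m" by metis
  \<comment> \<open>The 2 collects \<open>m\<close> once from \<open>f l\<close> and once from the
    bound \<open>M + m\<close> for the divided function on the circle. The factor
    \<open>4 * R / \<delta>\<close> is the growth of the bound at the remaining points when the
    Blaschke factor of \<open>l\<close> is divided out.\<close>
  show ?case
  proof (intro exI[of _ "2 + C * (4 * R / \<delta>)"] conjI allI impI)
    show "0 \<le> 2 + C * (4 * R / \<delta>)" using C0 \<delta> R by simp
  next
    fix S :: "complex set" and f :: "complex \<Rightarrow> complex" and M m :: real
    assume fin: "finite S" and card: "card S \<le> Suc n" and sub: "S \<subseteq> ball 0 R"
      and sep: "\<forall>x\<in>S. \<forall>y\<in>S. x \<noteq> y \<longrightarrow> \<delta> \<le> dist x y" and hol: "f holomorphic_on UNIV"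
      and M: "\<forall>w. norm w = R \<longrightarrow> norm (f w) \<le> M" and m: "\<forall>w\<in>S. norm (f w) \<le> m" "0 \<le> m"
    show "norm (f 0) \<le> (\<Prod>x\<in>S. norm x / R) * M + (2 + C * (4 * R / \<delta>)) * m"
    proof (cases "S = {}")
      case True
      have "norm (f 0) \<le> M" using entire_max_sphere[of f R M 0] hol M R by simp
      moreover have "0 \<le> (2 + C * (4 * R / \<delta>)) * m" using C0 \<delta> R m by simp
      ultimately show ?thesis using True by simp
    next
      case False
      then obtain l where l: "l \<in> S" by blast
      define T where "T = S - {l}"
      have lR: "norm l < R" using l sub by auto
      \<comment> \<open>\<open>q\<close> is the difference quotient with its singularity at
        \<open>l\<close> removed, and \<open>g\<close> is \<open>f - f l\<close> divided by the
        Blaschke factor \<open>R (w - l) / (R^2 - cnj l w)\<close>. Subtracting \<open>f l\<close>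
        first supplies the zero that cancels the pole.\<close>
      define q where "q = (\<lambda>w. if w = l then deriv f l else (f w - f l) / (w - l))"
      define g where "g = (\<lambda>w. q w * ((of_real (R\<^sup>2) - cnj l * w) / of_real R))"
      have q: "q holomorphic_on UNIV"
        unfolding q_def by (rule pole_lemma_open[OF hol]) simp
      have g: "g holomorphic_on UNIV"
        unfolding g_def by (intro holomorphic_intros q) (use R in auto)
      have gM: "norm (g w) \<le> M + m" if w: "norm w = R" for w
      proof -
        \<comment> \<open>On \<open>|w| = R\<close> the numerator \<open>R^2 - cnj l w\<close>
          equals \<open>w cnj (w - l)\<close>, so the Blaschke factor has modulus 1 there.\<close>
        have "of_real (R\<^sup>2) = w * cnj w"
          using w complex_norm_square by metis
        then have e: "of_real (R\<^sup>2) - cnj l * w = w * cnj (w - l)"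
          by (simp add: algebra_simps)
        have "w \<noteq> l" using w lR by auto
        then have "norm (g w) = norm (f w - f l)"
          using w R unfolding g_def q_def e by (simp add: norm_mult norm_divide flip: complex_cnj_diff)
        also have "\<dots> \<le> M + m"
          using norm_triangle_ineq4[of "f w" "f l"] M m(1) w l by fastforce
        finally show ?thesis .
      qed
      have gm: "norm (g w) \<le> 4 * R / \<delta> * m" if w: "w \<in> T" for w
      proof -
        have wl: "w \<noteq> l" "w \<in> S" and wR: "norm w < R" using w sub unfolding T_def by auto
        have "\<delta> \<le> norm (w - l)" using sep wl l by (auto simp: dist_norm)
        moreover have "norm (f w - f l) \<le> 2 * m"
          using norm_triangle_ineq4[of "f w" "f l"] m(1)[rule_format, of w] m(1)[rule_format, of l] wl l
          by linarith
        ultimately have A: "norm (q w) \<le> 2 * m / \<delta>"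
          unfolding q_def using wl \<delta> m by (auto simp: norm_divide intro!: frac_le)
        have "norm (of_real (R\<^sup>2) - cnj l * w) \<le> R\<^sup>2 + norm l * norm w"
          by (rule order_trans[OF norm_triangle_ineq4]) (simp add: norm_mult norm_power)
        also have "\<dots> \<le> R\<^sup>2 + R * R"
          using lR wR R by (intro add_left_mono mult_mono) auto
        finally have B: "norm ((of_real (R\<^sup>2) - cnj l * w) / of_real R) \<le> 2 * R"
          using R by (simp add: norm_divide divide_simps power2_eq_square)
        have "norm (g w) \<le> 2 * m / \<delta> * (2 * R)"
          unfolding g_def norm_mult using A B m \<delta> by (intro mult_mono) auto
        then show ?thesis by (simp add: algebra_simps)
      qed
      define P where "P = (\<Prod>x\<in>T. norm x / R)"
      have P: "0 \<le> P" "P \<le> 1"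
        unfolding P_def using R sub by (auto intro!: prod_nonneg prod_le_1 simp: T_def)
      have PS: "(\<Prod>x\<in>S. norm x / R) = norm l / R * P"
        unfolding P_def T_def by (rule prod.remove[OF fin l])
      have g0: "norm (g 0) \<le> P * (M + m) + C * (4 * R / \<delta> * m)"
        unfolding P_def
      proof (rule C)
        show "card T \<le> n" using card l fin by (simp add: T_def)
        show "\<forall>x\<in>T. \<forall>y\<in>T. x \<noteq> y \<longrightarrow> \<delta> \<le> dist x y" using sep by (simp add: T_def)
        show "0 \<le> 4 * R / \<delta> * m" using R \<delta> m by simp
      qed (use fin sub g gM gm in \<open>auto simp: T_def\<close>)
      \<comment> \<open>The Blaschke factor takes the value \<open>- l / R\<close> at 0, which
        supplies the new factor \<open>norm l / R\<close> of the product.\<close>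
      have "f 0 = f l - l / of_real R * g 0"
        using R by (simp add: g_def q_def field_simps power2_eq_square)
      then have "norm (f 0) \<le> norm (f l) + norm l / R * norm (g 0)"
        using norm_triangle_ineq4[of "f l" "l / of_real R * g 0"] R by (simp add: norm_mult norm_divide)
      also have "\<dots> \<le> m + norm l / R * (P * (M + m) + C * (4 * R / \<delta> * m))"
        using m(1) l g0 R by (intro add_mono mult_left_mono) auto
      also have "\<dots> = m + norm l / R * P * M + (norm l / R) * (P * m + C * (4 * R / \<delta> * m))"
        by (simp add: algebra_simps)
      also have "\<dots> \<le> m + norm l / R * P * M + 1 * (1 * m + C * (4 * R / \<delta> * m))"
        using lR R P m C0 \<delta> by (intro add_mono mult_mono order_refl) auto
      finally show ?thesis unfolding PS by (simp add: algebra_simps)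
    qed
  qed
qed

text \<open>A discrete form of \<open>log (M/x) = \<integral> dt/t\<close> over \<open>[x, M]\<close>, which turns Jensen's product into counts of
  points in discs.\<close>

lemma discrete_log_estimate:
  fixes x :: real
  assumes "0 \<le> x" "x \<le> real M" "M \<ge> 1"
  shows "x / M \<le> exp (- (\<Sum>i\<in>{1..<M}. if x \<le> i then 1 / (real i + 1) else 0))"
  using assms(3,2)
proof (induction M rule: dec_induct)
  case base
  then show ?case by simp
next
  case (step M)
  show ?case
  proof (cases "x \<le> M")
    case True
    \<comment> \<open>Passing from \<open>M\<close> to \<open>M + 1\<close> costs the factor
      \<open>1 - 1 / (M + 1) <= exp (- 1 / (M + 1))\<close>, which matches the new summand
      \<open>i = M\<close>.\<close>
    have "x / Suc M = x / M * (1 - 1 / (real M + 1))"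
      using step by (simp add: field_simps)
    also have "\<dots> \<le> exp (- (\<Sum>i\<in>{1..<M}. if x \<le> i then 1 / (real i + 1) else 0)) * exp (- (1 / (real M + 1)))"
      using step.IH True exp_ge_add_one_self[of "- (1 / (real M + 1))"] assms(1)
      by (intro mult_mono) auto
    finally show ?thesis using True step by (simp add: exp_add[symmetric] atLeastLessThanSuc algebra_simps)
  next
    case False
    then have "(\<Sum>i\<in>{1..<Suc M}. if x \<le> i then 1 / (real i + 1) else 0) = 0"
      by (intro sum.neutral) auto
    then show ?thesis using step by (simp add: field_simps)
  qed
qed


section \<open>Counting points in discs\<close>

text \<open>In a grid of squares of side \<open>\<delta> / 2\<close> no square holds two points of
  \<open>\<Lambda>\<close>. Letting the grid move with \<open>z\<close> makes the index range
  \<open>B \<times> B\<close>, and hence the bound, independent of \<open>z\<close>.\<close>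

lemma uniformly_discrete_card_ball:
  fixes \<Lambda> :: "complex set"
  assumes \<delta>: "\<delta> > 0" and sep: "\<And>x y. x \<in> \<Lambda> \<Longrightarrow> y \<in> \<Lambda> \<Longrightarrow> dist x y < \<delta> \<Longrightarrow> x = y"
  shows "\<exists>N. \<forall>z. finite (\<Lambda> \<inter> ball z R) \<and> card (\<Lambda> \<inter> ball z R) \<le> N"
proof -
  define B where "B = {-\<lceil>R * 2 / \<delta>\<rceil> .. \<lceil>R * 2 / \<delta>\<rceil>}"
  have fin: "finite (B \<times> B)" by (simp add: B_def)
  have fl: "\<lfloor>x * 2 / \<delta>\<rfloor> \<in> B" if "\<bar>x\<bar> < R" for x
  proof -
    have "x * 2 / \<delta> \<le> R * 2 / \<delta>" "- (R * 2 / \<delta>) \<le> x * 2 / \<delta>"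
      using that \<delta> by (auto simp: field_simps)
    then show ?thesis unfolding B_def by (auto simp: floor_le_iff le_floor_iff) linarith+
  qed
  have close: "\<bar>x - y\<bar> < \<delta> / 2" if "\<lfloor>x * 2 / \<delta>\<rfloor> = \<lfloor>y * 2 / \<delta>\<rfloor>" for x y
  proof -
    have "\<bar>x * 2 / \<delta> - y * 2 / \<delta>\<bar> < 1" using that by linarith
    then have "\<bar>x * 2 / \<delta> - y * 2 / \<delta>\<bar> * (\<delta> / 2) < 1 * (\<delta> / 2)"
      using \<delta> by (intro mult_strict_right_mono) auto
    moreover have "x - y = (x * 2 / \<delta> - y * 2 / \<delta>) * (\<delta> / 2)" using \<delta> by (simp add: field_simps)
    then have "\<bar>x - y\<bar> = \<bar>x * 2 / \<delta> - y * 2 / \<delta>\<bar> * (\<delta> / 2)"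
      using \<delta> by (metis abs_mult abs_of_pos half_gt_zero)
    ultimately show ?thesis by simp
  qed
  have "finite (\<Lambda> \<inter> ball z R) \<and> card (\<Lambda> \<inter> ball z R) \<le> card (B \<times> B)" for z
  proof -
    define \<phi> where "\<phi> = (\<lambda>w. (\<lfloor>Re (w - z) * 2 / \<delta>\<rfloor>, \<lfloor>Im (w - z) * 2 / \<delta>\<rfloor>))"
    have inj: "inj_on \<phi> (\<Lambda> \<inter> ball z R)"
    proof (rule inj_onI)
      fix x y assume xy: "x \<in> \<Lambda> \<inter> ball z R" "y \<in> \<Lambda> \<inter> ball z R" "\<phi> x = \<phi> y"
      have "\<bar>Re (x - y)\<bar> < \<delta> / 2" "\<bar>Im (x - y)\<bar> < \<delta> / 2"
        using close[of "Re (x - z)" "Re (y - z)"] close[of "Im (x - z)" "Im (y - z)"] xy(3)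
        by (auto simp: \<phi>_def)
      then have "dist x y < \<delta>" using cmod_le[of "x - y"] unfolding dist_norm by linarith
      then show "x = y" using sep xy by blast
    qed
    have sub: "\<phi> ` (\<Lambda> \<inter> ball z R) \<subseteq> B \<times> B"
    proof -
      have "\<phi> w \<in> B \<times> B" if "w \<in> ball z R" for w
      proof -
        have "norm (w - z) < R" using that by (simp add: dist_norm norm_minus_commute)
        then have "\<bar>Re (w - z)\<bar> < R" "\<bar>Im (w - z)\<bar> < R"
          using abs_Re_le_cmod[of "w - z"] abs_Im_le_cmod[of "w - z"] by linarith+
        then show ?thesis using fl unfolding \<phi>_def by blast
      qed
      then show ?thesis by blast
    qed
    show ?thesis
      using inj_on_finite[OF inj sub fin] card_inj_on_le[OF inj sub fin] by blast
  qed
  then show ?thesis by blast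
qed

text \<open>Area comparison: the unit squares about the points of \<open>K\<close> cover
  \<open>ball 0 (t - 2)\<close>, since rounding both coordinates moves a point by at most 1. The
  slack 1 in \<open>K\<close> leaves room for the squares that are packed into a disc later, after
  scaling.\<close>

lemma card_lattice_disc:
  fixes t :: real
  assumes t: "t \<ge> 2"
  defines "K \<equiv> {(a :: int, b :: int). norm (Complex a b) + 1 \<le> t}"
  shows "finite K" "pi * (t - 2)\<^sup>2 \<le> card K"
proof -
  have "K \<subseteq> {-\<lceil>t\<rceil>..\<lceil>t\<rceil>} \<times> {-\<lceil>t\<rceil>..\<lceil>t\<rceil>}"
  proof
    fix p assume p: "p \<in> K"
    obtain a b where ab: "p = (a, b)" by force
    have "\<bar>real_of_int a\<bar> \<le> t" "\<bar>real_of_int b\<bar> \<le> t"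
      using p abs_Re_le_cmod[of "Complex a b"] abs_Im_le_cmod[of "Complex a b"]
      unfolding ab K_def by auto
    then show "p \<in> {-\<lceil>t\<rceil>..\<lceil>t\<rceil>} \<times> {-\<lceil>t\<rceil>..\<lceil>t\<rceil>}"
      unfolding ab by (auto simp: abs_le_iff) linarith+
  qed
  then show fin: "finite K" using finite_subset by blast
  define Q where "Q = (\<lambda>(a, b). cbox (Complex (of_int a - 1/2) (of_int b - 1/2)) (Complex (of_int a + 1/2) (of_int b + 1/2)))"
  show "pi * (t - 2)\<^sup>2 \<le> card K"
  proof -
    have cover: "ball 0 (t - 2) \<subseteq> (\<Union>p\<in>K. Q p)"
    proof
      fix w :: complex assume w: "w \<in> ball 0 (t - 2)"
      define c where "c = Complex (round (Re w)) (round (Im w))"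
      have d: "\<bar>Re (c - w)\<bar> \<le> 1/2" "\<bar>Im (c - w)\<bar> \<le> 1/2"
        unfolding c_def using of_int_round_abs_le by auto
      have "norm c \<le> norm w + norm (c - w)" using norm_triangle_sub by blast
      also have "norm (c - w) \<le> 1" using cmod_le[of "c - w"] d by linarith
      finally have "(round (Re w), round (Im w)) \<in> K" using w by (simp add: K_def c_def)
      moreover have "w \<in> Q (round (Re w), round (Im w))"
      proof -
        have "Re w \<le> Re c + 1/2" "Re c - 1/2 \<le> Re w" "Im w \<le> Im c + 1/2" "Im c - 1/2 \<le> Im w"
          using d[unfolded abs_le_iff] by auto
        then show ?thesis by (simp add: c_def Q_def cbox_def Basis_complex_def)
      qed
      ultimately show "w \<in> (\<Union>p\<in>K. Q p)" by blast
    qed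
    have Q1: "measure lborel (Q p) = 1" for p
      by (cases p) (simp add: Q_def content_cbox Basis_complex_def)
    have Qs: "Q p \<in> sets lborel" for p by (cases p) (simp add: Q_def)
    have Qc: "compact (Q p)" for p by (cases p) (simp add: Q_def)
    have "measure lborel (ball 0 (t - 2) :: complex set) \<le> measure lborel (\<Union>p\<in>K. Q p)"
      by (intro measure_mono_fmeasurable fmeasurable_compact cover compact_UN fin Qc) simp
    also have "\<dots> \<le> (\<Sum>p\<in>K. measure lborel (Q p))"
      by (intro measure_UNION_le fin Qs)
    also have "\<dots> = card K" by (simp add: Q1)
    finally show ?thesis using t by (simp add: content_ball unit_ball_vol_2)
  qed
qed

text \<open>Copies of the square of side \<open>r\<close> are packed into the disc along a lattice
  of spacing \<open>L = r * s\<close>. Since \<open>L > r\<close>, the closed copies are disjoint,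
  so their counts add up.\<close>

lemma disc_count_from_square_count:
  fixes \<Lambda> :: "complex set"
  assumes fin: "\<And>z R. finite (\<Lambda> \<inter> ball z R)" and D: "0 < D'" "D' < D" and r: "r > 0"
    and sq: "\<And>z. D * r\<^sup>2 \<le> card (\<Lambda> \<inter> (\<lambda>w. complex_of_real r * w + z) ` unit_square)"
  shows "\<exists>t0>0. \<forall>t\<ge>t0. \<forall>z. D' * pi * t\<^sup>2 \<le> card (\<Lambda> \<inter> cball z t)"
proof -
  \<comment> \<open>Of \<open>s ^ 4 = D / D'\<close>, one factor \<open>s^2\<close> pays for the
    gaps between the squares and the other for the boundary layer: the threshold for
    \<open>t\<close> is where \<open>t - 2 * L \<ge> t / s\<close>.\<close>
  define s where "s = root 4 (D / D')"
  have s: "s > 1" "s ^ 4 = D / D'"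
    using D by (auto simp: s_def real_root_gt_1_iff)
  define L where "L = r * s"
  have L: "L > r" "L > 0" using r s(1) by (auto simp: L_def intro: less_trans)
  have t: "D' * pi * t\<^sup>2 \<le> card (\<Lambda> \<inter> cball z t)" if t: "t \<ge> 2 * L * s / (s - 1)" for t z
  proof -
    define K where "K = {(a :: int, b :: int). norm (Complex a b) + 1 \<le> t / L}"
    have "t * (s - 1) \<ge> 2 * L * s" using t s(1) by (simp add: field_simps)
    then have ts: "t - 2 * L \<ge> t / s" using s(1) by (simp add: field_simps)
    have tp: "t > 0" using t s(1) L by (smt (verit) divide_pos_pos mult_pos_pos)
    then have "t / s > 0" using s(1) by simp
    with ts have "t > 2 * L" by linarith
    then have tL: "t / L \<ge> 2" using L by (simp add: field_simps)
    have K: "finite K" "pi * (t / L - 2)\<^sup>2 \<le> card K"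
      using card_lattice_disc[of "t / L"] tL unfolding K_def by auto
    define Q where "Q = (\<lambda>(a :: int, b :: int). (\<lambda>w. complex_of_real r * w + (z + of_real L * Complex a b)) ` unit_square)"
    have Qin: "\<bar>Re (x - z) - L * a\<bar> \<le> r / 2 \<and> \<bar>Im (x - z) - L * b\<bar> \<le> r / 2" if "x \<in> Q (a, b)" for x a b
      using that r unfolding Q_def unit_square_def by (auto simp: abs_mult)
    have aux: "a = a'" if "\<bar>x - L * of_int a\<bar> \<le> r / 2" "\<bar>x - L * of_int a'\<bar> \<le> r / 2" for x :: real and a a' :: int
    proof -
      have "\<bar>L * (of_int a - of_int a')\<bar> \<le> r" using that unfolding right_diff_distrib by linarith
      also have "r < L * 1" using L by simp
      finally have "\<bar>real_of_int a - of_int a'\<bar> < 1" using L by (simp add: abs_mult)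
      then show ?thesis by linarith
    qed
    have disj: "Q p \<inter> Q p' = {}" if "p \<noteq> p'" for p p'
    proof -
      obtain a b a' b' where "p = (a, b)" "p' = (a', b')" by (metis surj_pair)
      then show ?thesis using Qin aux that by blast
    qed
    have Qsub: "Q p \<subseteq> cball z t" if pK: "p \<in> K" for p
    proof
      fix x assume x: "x \<in> Q p"
      obtain a b where p: "p = (a, b)" by force
      define c where "c = of_real L * Complex a b"
      have "\<bar>Re (x - z - c)\<bar> \<le> r / 2" "\<bar>Im (x - z - c)\<bar> \<le> r / 2"
        using Qin x unfolding p c_def by auto
      then have "norm (x - z - c) \<le> L" using cmod_le[of "x - z - c"] L by linarith
      moreover have "norm c \<le> t - L"
        using pK L unfolding p K_def c_def by (simp add: norm_mult field_simps)
      moreover have "norm (x - z) \<le> norm c + norm (x - z - c)" using norm_triangle_sub by blast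
      ultimately show "x \<in> cball z t" by (simp add: dist_norm norm_minus_commute)
    qed
    have fint: "finite (\<Lambda> \<inter> cball z t)"
      by (rule finite_subset[OF _ fin[of z "t + 1"]]) auto
    have DL: "D' * s ^ 4 = D" using s(2) D by (simp add: field_simps)
    have "D' * pi * t\<^sup>2 = D' * pi * s\<^sup>2 * (t / s)\<^sup>2" using s(1) by (simp add: field_simps)
    also have "\<dots> \<le> D' * pi * s\<^sup>2 * (t - 2 * L)\<^sup>2"
      using ts tp s(1) D by (intro mult_left_mono power_mono) auto
    also have "\<dots> = D' * s ^ 4 * r\<^sup>2 * (pi * (t / L - 2)\<^sup>2)"
    proof -
      have "t - 2 * L = L * (t / L - 2)" using L by (simp add: field_simps)
      then have "(t - 2 * L)\<^sup>2 = s\<^sup>2 * r\<^sup>2 * (t / L - 2)\<^sup>2"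
        by (simp add: power_mult_distrib L_def)
      then show ?thesis by (simp add: power2_eq_square power4_eq_xxxx)
    qed
    also have "\<dots> \<le> D * r\<^sup>2 * card K"
      unfolding DL using K D by (intro mult_left_mono) auto
    also have "\<dots> = (\<Sum>p\<in>K. D * r\<^sup>2)" by simp
    also have "\<dots> \<le> (\<Sum>p\<in>K. real (card (\<Lambda> \<inter> Q p)))"
      by (intro sum_mono) (auto simp: Q_def sq)
    also have "\<dots> = real (\<Sum>p\<in>K. card (\<Lambda> \<inter> Q p))" by simp
    also have "(\<Sum>p\<in>K. card (\<Lambda> \<inter> Q p)) = card (\<Union>p\<in>K. \<Lambda> \<inter> Q p)"
    proof (rule card_UN_disjoint[symmetric])
      show "\<forall>p\<in>K. finite (\<Lambda> \<inter> Q p)" using Qsub by (auto intro: finite_subset[OF _ fint])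
      show "\<forall>p\<in>K. \<forall>p'\<in>K. p \<noteq> p' \<longrightarrow> (\<Lambda> \<inter> Q p) \<inter> (\<Lambda> \<inter> Q p') = {}"
        using disj by blast
    qed (rule K)
    also have "real \<dots> \<le> card (\<Lambda> \<inter> cball z t)"
      using Qsub fint by (intro of_nat_mono card_mono) auto
    finally show ?thesis .
  qed
  have "2 * L * s / (s - 1) > 0" using L s(1) by simp
  then show ?thesis using t by blast
qed

section \<open>Jensen's product from disc counts\<close>

text \<open>\<open>discrete_log_estimate\<close> is applied to each point with \<open>R\<close>
  rescaled to \<open>M\<close>. After the sums are exchanged, the points active at index
  \<open>i\<close> are those in the disc of radius \<open>R * i / M\<close>. As \<open>M\<close>
  grows, the exponent tends to \<open>- D pi R^2 / 2\<close>, the value in Jensen's formula for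
  points of constant density \<open>D\<close>.\<close>

lemma prod_le_from_disc_count:
  fixes \<Lambda> :: "complex set" and M :: nat
  assumes fin: "finite (\<Lambda> \<inter> ball z R)" and R: "R > 0" and M: "M \<ge> 1" and D: "D \<ge> 0"
    and cnt: "\<And>t. t \<ge> R / M \<Longrightarrow> D * pi * t\<^sup>2 \<le> card (\<Lambda> \<inter> cball z t)"
  shows "(\<Prod>x\<in>\<Lambda> \<inter> ball z R. norm (x - z) / R) \<le>
     exp (- (D * pi * R\<^sup>2 * (real M - 1) * (real M - 2) / (2 * M\<^sup>2)))"
proof -
  define S where "S = \<Lambda> \<inter> ball z R"
  define \<phi> where "\<phi> = (\<lambda>x i. if norm (x - z) * M / R \<le> real i then 1 / (real i + 1) else 0 :: real)"
  have "(\<Prod>x\<in>S. norm (x - z) / R) \<le> (\<Prod>x\<in>S. exp (- (\<Sum>i\<in>{1..<M}. \<phi> x i)))"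
  proof (rule prod_mono, intro conjI)
    fix x assume "x \<in> S"
    then have "norm (x - z) < R" by (simp add: S_def dist_norm norm_minus_commute)
    then have "norm (x - z) * M / R \<le> M" using R M by (simp add: field_simps)
    then show "norm (x - z) / R \<le> exp (- (\<Sum>i\<in>{1..<M}. \<phi> x i))"
      using discrete_log_estimate[of "norm (x - z) * M / R" M] M R by (simp add: \<phi>_def)
  qed (use R in simp)
  also have "\<dots> = exp (- (\<Sum>x\<in>S. \<Sum>i\<in>{1..<M}. \<phi> x i))"
    using fin by (simp add: S_def exp_sum sum_negf[symmetric])
  also have "(\<Sum>x\<in>S. \<Sum>i\<in>{1..<M}. \<phi> x i) = (\<Sum>i\<in>{1..<M}. \<Sum>x\<in>S. \<phi> x i)"
    by (rule sum.swap)
  also have "exp (- (\<Sum>i\<in>{1..<M}. \<Sum>x\<in>S. \<phi> x i)) \<le>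
      exp (- (\<Sum>i\<in>{1..<M}. D * pi * R\<^sup>2 / M\<^sup>2 * (real i - 1)))"
  proof (subst exp_le_cancel_iff, subst neg_le_iff_le, rule sum_mono)
    fix i assume i: "i \<in> {1..<M}"
    have iM: "R * i / M < R" using i R M by (simp add: field_simps)
    have "{x. norm (x - z) * M / R \<le> real i} = cball z (R * i / M)"
      using R M by (auto simp: dist_norm norm_minus_commute field_simps)
    moreover have "cball z (R * i / M) \<subseteq> ball z R" using iM by auto
    ultimately have eq: "S \<inter> {x. norm (x - z) * M / R \<le> real i} = \<Lambda> \<inter> cball z (R * i / M)"
      unfolding S_def by blast
    \<comment> \<open>Replacing \<open>i^2 / (i + 1)\<close> by \<open>i - 1\<close> gives a sum in
      closed form; the loss is of lower order in \<open>M\<close>.\<close>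
    have "D * pi * R\<^sup>2 / M\<^sup>2 * (real i - 1) \<le> D * pi * R\<^sup>2 / M\<^sup>2 * ((real i)\<^sup>2 / (real i + 1))"
    proof (rule mult_left_mono)
      show "real i - 1 \<le> (real i)\<^sup>2 / (real i + 1)"
        by (simp add: field_simps power2_eq_square)
    qed (use D in simp)
    also have "\<dots> = D * pi * (R * i / M)\<^sup>2 / (real i + 1)"
      by (simp add: power_mult_distrib power_divide)
    also have "\<dots> \<le> card (\<Lambda> \<inter> cball z (R * i / M)) / (real i + 1)"
      using i R M by (intro divide_right_mono cnt) (auto simp: field_simps)
    also have "\<dots> = (\<Sum>x\<in>S. \<phi> x i)"
      unfolding \<phi>_def eq[symmetric] using fin by (simp add: S_def sum.If_cases)
    finally show "D * pi * R\<^sup>2 / M\<^sup>2 * (real i - 1) \<le> (\<Sum>x\<in>S. \<phi> x i)" .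
  qed
  also have "(\<Sum>i\<in>{1..<M}. D * pi * R\<^sup>2 / M\<^sup>2 * (real i - 1)) =
      D * pi * R\<^sup>2 / M\<^sup>2 * (\<Sum>i\<in>{1..<M}. real i - 1)"
    by (simp add: sum_distrib_left)
  also have "(\<Sum>i\<in>{1..<M}. real i - 1) = (real M - 1) * (real M - 2) / 2"
    using M by (induction M rule: dec_induct) (auto simp: atLeastLessThanSuc field_simps)
  finally show ?thesis unfolding S_def by (simp add: field_simps)
qed

section \<open>Sampling estimates\<close>

text \<open>A fine subdivision makes the constant in Jensen's product exceed \<open>a\<close>, and a
  large \<open>R\<close> then gains the factor 1/2, which \<open>sampling_estimate_global\<close>
  needs for absorption. \<open>C\<close> does not depend on \<open>z\<close> because the number of
  points in \<open>ball z R\<close> is bounded uniformly.\<close>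

lemma sampling_estimate_local:
  fixes \<Lambda> :: "complex set"
  assumes \<delta>: "\<delta> > 0" and sep: "\<And>x y. x \<in> \<Lambda> \<Longrightarrow> y \<in> \<Lambda> \<Longrightarrow> dist x y < \<delta> \<Longrightarrow> x = y"
    and D: "D > 0" and t0: "t0 > 0"
    and cnt: "\<And>t z. t \<ge> t0 \<Longrightarrow> D * pi * t\<^sup>2 \<le> card (\<Lambda> \<inter> cball z t)"
    and a: "a < D * pi / 2"
  shows "\<exists>R>0. \<exists>C\<ge>0. \<forall>z g M m. g holomorphic_on UNIV \<longrightarrow> (\<forall>w. dist z w = R \<longrightarrow> norm (g w) \<le> M) \<longrightarrow>
     (\<forall>w\<in>\<Lambda> \<inter> ball z R. norm (g w) \<le> m) \<longrightarrow> 0 \<le> M \<longrightarrow> 0 \<le> m \<longrightarrow>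
     norm (g z :: complex) \<le> exp (- (a * R\<^sup>2)) / 2 * M + C * m"
proof -
  \<comment> \<open>The constant of \<open>prod_le_from_disc_count\<close> is
    \<open>D * pi / 2\<close> times a factor tending to 1, so some subdivision number
    \<open>n\<close> brings it above \<open>a\<close>.\<close>
  have "((\<lambda>x::real. D * pi * ((1 - 1 / x) * (1 - 2 / x)) / 2) \<longlongrightarrow> D * pi * ((1 - 0) * (1 - 0)) / 2) at_top"
    by (intro tendsto_intros tendsto_divide_0[OF tendsto_const] filterlim_at_top_imp_at_infinity filterlim_ident) auto
  then have "\<forall>\<^sub>F x::real in at_top. a < D * pi * ((1 - 1 / x) * (1 - 2 / x)) / 2"
    using a by (intro order_tendstoD) auto
  then have "\<forall>\<^sub>F n in sequentially. a < D * pi * ((1 - 1 / real n) * (1 - 2 / real n)) / 2"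
    by (rule eventually_compose_filterlim[OF _ filterlim_real_sequentially])
  then obtain n :: nat where n: "n \<ge> 1" "a < D * pi * ((1 - 1 / real n) * (1 - 2 / real n)) / 2"
    using eventually_conj[OF eventually_ge_at_top[of "1::nat"]] eventually_happens'
    by (metis (no_types, lifting) sequentially_bot)
  define c where "c = D * pi * (real n - 1) * (real n - 2) / (2 * (real n)\<^sup>2)"
  have c: "a < c"
    using n by (simp add: c_def field_simps power2_eq_square)
  \<comment> \<open>The summand \<open>n * t0\<close> raises the smallest radius used,
    \<open>R / n\<close>, to at least \<open>t0\<close>. The other two give
    \<open>R^2 \<ge> ln 2 / (c - a)\<close>, that is, the factor 1/2.\<close>
  define R where "R = n * t0 + 1 + ln 2 / (c - a)"
  have "ln 2 / (c - a) > 0" "n * t0 > 0" using c n t0 by auto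
  then have R: "R \<ge> 1" "R \<ge> ln 2 / (c - a)" "R \<ge> n * t0"
    by (auto simp: R_def)
  have "R * 1 \<le> R * R" using R by (intro mult_left_mono) auto
  then have "ln 2 / (c - a) \<le> R\<^sup>2" using R(2) by (simp add: power2_eq_square)
  then have "ln 2 \<le> (c - a) * R\<^sup>2" using c by (simp add: field_simps)
  then have "exp (- (c * R\<^sup>2)) \<le> exp (- (a * R\<^sup>2) - ln 2)" by (simp add: algebra_simps)
  then have small: "exp (- (c * R\<^sup>2)) \<le> exp (- (a * R\<^sup>2)) / 2" by (simp add: exp_diff)
  obtain N where N: "\<And>z. finite (\<Lambda> \<inter> ball z R)" "\<And>z. card (\<Lambda> \<inter> ball z R) \<le> N"
    using uniformly_discrete_card_ball[OF \<delta> sep] by metis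
  have "R > 0" using R by simp
  from finite_blaschke_estimate[OF \<delta> this, of N] obtain C where C0: "C \<ge> 0" and
    C: "\<And>S f M m. \<lbrakk>finite S; card S \<le> N; S \<subseteq> ball 0 R;
      \<forall>x\<in>S. \<forall>y\<in>S. x \<noteq> y \<longrightarrow> \<delta> \<le> dist x y; f holomorphic_on UNIV;
      \<forall>w. norm w = R \<longrightarrow> norm (f w) \<le> M; \<forall>w\<in>S. norm (f w) \<le> m; 0 \<le> m\<rbrakk> \<Longrightarrow>
      norm (f 0 :: complex) \<le> (\<Prod>x\<in>S. norm x / R) * M + C * m" by metis
  have "norm (g z) \<le> exp (- (a * R\<^sup>2)) / 2 * M + C * m"
    if g: "g holomorphic_on UNIV" and M: "\<forall>w. dist z w = R \<longrightarrow> norm (g w) \<le> M" "0 \<le> M"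
      and m: "\<forall>w\<in>\<Lambda> \<inter> ball z R. norm (g w) \<le> m" "0 \<le> m" for z g M m
  proof -
    define S where "S = (\<lambda>x. x - z) ` (\<Lambda> \<inter> ball z R)"
    have inj: "inj_on (\<lambda>x. x - z) (\<Lambda> \<inter> ball z R)" by (simp add: inj_on_def)
    have hol: "(\<lambda>w. g (z + w)) holomorphic_on UNIV"
      using holomorphic_on_compose[of "\<lambda>w. z + w" UNIV g] g holomorphic_on_subset
      by (simp add: o_def holomorphic_intros)
    have "norm (g (z + 0)) \<le> (\<Prod>x\<in>S. norm x / R) * M + C * m"
    proof (rule C)
      show "finite S" "card S \<le> N" using N inj by (auto simp: S_def card_image)
      show "S \<subseteq> ball 0 R" by (auto simp: S_def dist_norm norm_minus_commute)
      show "\<forall>x\<in>S. \<forall>y\<in>S. x \<noteq> y \<longrightarrow> \<delta> \<le> dist x y"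
        using sep by (force simp: S_def dist_norm)
      show "\<forall>w. norm w = R \<longrightarrow> norm (g (z + w)) \<le> M" using M by (simp add: dist_norm)
      show "\<forall>w\<in>S. norm (g (z + w)) \<le> m" using m by (auto simp: S_def)
    qed (use hol m in auto)
    also have "(\<Prod>x\<in>S. norm x / R) = (\<Prod>x\<in>\<Lambda> \<inter> ball z R. norm (x - z) / R)"
      unfolding S_def by (simp add: prod.reindex[OF inj])
    also have "\<dots> \<le> exp (- (c * R\<^sup>2))"
    proof -
      have "\<And>t. t \<ge> R / n \<Longrightarrow> D * pi * t\<^sup>2 \<le> card (\<Lambda> \<inter> cball z t)"
      proof -
        fix t assume "R / n \<le> t"
        moreover have "t0 \<le> R / n" using R(3) n(1) by (simp add: field_simps)
        ultimately show "D * pi * t\<^sup>2 \<le> card (\<Lambda> \<inter> cball z t)" by (intro cnt) linarith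
      qed
      from prod_le_from_disc_count[OF N(1) \<open>R > 0\<close> n(1) less_imp_le[OF D] this]
      show ?thesis by (simp add: c_def mult_ac)
    qed
    also note small
    finally show ?thesis using M by (simp add: mult_right_mono)
  qed
  then show ?thesis using C0 \<open>R > 0\<close> by blast
qed

text \<open>Let \<open>p\<close> maximise the Gaussian-weighted modulus \<open>G\<close> over a
  large disc. Near the boundary the growth bound makes \<open>G p\<close> smaller than
  \<open>norm (f z0)\<close>, which is impossible. Otherwise the circle of radius \<open>R\<close>
  about \<open>p\<close> stays in the disc, \<open>G\<close> is at most \<open>G p\<close> on it,
  and \<open>local\<close> bounds \<open>G p\<close> by \<open>G p / 2\<close> plus a multiple of
  \<open>A\<close>; the half is absorbed.\<close>

lemma sampling_estimate_global:
  fixes \<Lambda> :: "complex set" and f :: "complex \<Rightarrow> complex"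
  assumes f: "f holomorphic_on UNIV" and a: "a > 0" and R: "R > 0" and C: "C \<ge> 0"
    and local: "\<And>z g M m. \<lbrakk>g holomorphic_on UNIV; \<forall>w. dist z w = R \<longrightarrow> norm (g w) \<le> M;
        \<forall>w\<in>\<Lambda> \<inter> ball z R. norm (g w) \<le> m; 0 \<le> M; 0 \<le> m\<rbrakk> \<Longrightarrow>
        norm (g z :: complex) \<le> exp (- (a * R\<^sup>2)) / 2 * M + C * m"
    and growth: "\<exists>\<^sub>F r in at_top. \<forall>w. norm w = r \<longrightarrow> norm (f w) \<le> exp (b * r\<^sup>2)"
    and b: "b < a" and A: "A \<ge> 0"
    and bound: "\<And>x. x \<in> \<Lambda> \<Longrightarrow> norm (f x) \<le> A * exp (a * (norm (x - z0))\<^sup>2)"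
  shows "norm (f z0) \<le> 2 * C * exp (a * R\<^sup>2) * A"
proof (rule ccontr)
  assume neg: "\<not> norm (f z0) \<le> 2 * C * exp (a * R\<^sup>2) * A"
  moreover have "0 \<le> 2 * C * exp (a * R\<^sup>2) * A" using C A by simp
  ultimately have fz: "norm (f z0) > 0" by linarith
  \<comment> \<open>Every point with \<open>norm p \<ge> r - R\<close> has distance at least
    \<open>r - c\<close> from \<open>z0\<close>.\<close>
  define c where "c = R + norm z0"
  have c: "c > 0" using R by (simp add: c_def add_pos_nonneg)
  \<comment> \<open>The second condition gives \<open>b r^2 - a (r - c)^2 <= - r\<close>, and the
    third puts \<open>- r\<close> below \<open>ln (norm (f z0))\<close>.\<close>
  have "\<forall>\<^sub>F r in at_top. r > c \<and> r \<ge> (2 * a * c + 1) / (a - b) \<and> r > - ln (norm (f z0))"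
    by (intro eventually_conj eventually_gt_at_top eventually_ge_at_top)
  from frequently_eventually_frequently[OF growth this] obtain r where
    r: "\<And>w. norm w = r \<Longrightarrow> norm (f w) \<le> exp (b * r\<^sup>2)" "r > c" "r \<ge> (2 * a * c + 1) / (a - b)"
      "r > - ln (norm (f z0))"
    by (auto dest!: frequently_ex)
  have rp: "r > 0" using r c by simp
  have small: "exp (b * r\<^sup>2 - a * (r - c)\<^sup>2) < norm (f z0)"
  proof -
    have "(a - b) * r \<ge> 2 * a * c + 1" using r(3) b by (simp add: field_simps)
    then have "((a - b) * r - 2 * a * c) * r \<ge> 1 * r"
      using rp by (intro mult_right_mono) auto
    moreover have "a * c\<^sup>2 \<ge> 0" using a by simp
    ultimately have "b * r\<^sup>2 - a * (r - c)\<^sup>2 \<le> - r"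
      by (simp add: power2_eq_square algebra_simps)
    also have "\<dots> < ln (norm (f z0))" using r(4) by simp
    finally have "exp (b * r\<^sup>2 - a * (r - c)\<^sup>2) < exp (ln (norm (f z0)))" by (simp only: exp_less_cancel_iff)
    then show ?thesis using exp_ln[OF fz] by simp
  qed
  define G where "G = (\<lambda>w. norm (f w) * exp (- (a * (norm (w - z0))\<^sup>2)))"
  have "continuous_on (cball 0 r) G"
    unfolding G_def using f holomorphic_on_imp_continuous_on holomorphic_on_subset
    by (intro continuous_intros) blast
  moreover have "cball 0 r \<noteq> ({} :: complex set)" using rp by simp
  ultimately obtain p where p: "p \<in> cball 0 r" "\<And>w. w \<in> cball 0 r \<Longrightarrow> G w \<le> G p"
    using continuous_attains_sup[OF compact_cball] by metis
  have "z0 \<in> cball 0 r" using r(2) R by (simp add: c_def)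
  then have Gz: "norm (f z0) \<le> G p" using p(2)[of z0] by (simp add: G_def)
  show False
  proof (cases "norm p < r - R")
    case False
    have "norm (f p) \<le> exp (b * r\<^sup>2)"
      using entire_max_sphere[OF f, of r] r(1) p(1) by simp
    moreover have "r - c \<le> norm (p - z0)"
      using False norm_triangle_ineq2[of p z0] by (simp add: c_def)
    then have "(r - c)\<^sup>2 \<le> (norm (p - z0))\<^sup>2" using r(2) by (intro power_mono) auto
    then have "exp (- (a * (norm (p - z0))\<^sup>2)) \<le> exp (- (a * (r - c)\<^sup>2))"
      using a by simp
    ultimately have "G p \<le> exp (b * r\<^sup>2) * exp (- (a * (r - c)\<^sup>2))"
      unfolding G_def by (intro mult_mono) auto
    then show False using small Gz by (simp add: exp_add[symmetric])
  next
    case True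
    \<comment> \<open>The exponential recentres the Gaussian weight: \<open>|g(w)|\<close> is \<open>G(w) exp(a |w - p|\<^sup>2)\<close> up to a constant.\<close>
    define g where "g = (\<lambda>w. f w * exp (- (2 * of_real a * (cnj (p - z0) * (w - p)))))"
    define E where "E = exp (a * (norm (p - z0))\<^sup>2)"
    have E: "E > 0" by (simp add: E_def)
    have hol: "g holomorphic_on UNIV"
      unfolding g_def by (intro holomorphic_intros f)
    have ng: "norm (g w) = norm (f w) * exp (- (a * (norm (w - z0))\<^sup>2)) * E * exp (a * (norm (w - p))\<^sup>2)" for w
    proof -
      have "(norm (w - z0))\<^sup>2 = (norm (p - z0))\<^sup>2 + (norm (w - p))\<^sup>2 + 2 * Re (cnj (p - z0) * (w - p))"
        unfolding cmod_power2 by (simp add: power2_eq_square algebra_simps)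
      moreover have "X = Y + Z + 2 * u \<Longrightarrow> - (2 * a * u) = - (a * X) + a * Y + a * Z" for X Y Z u
        by (simp add: algebra_simps)
      ultimately have "- (2 * a * Re (cnj (p - z0) * (w - p))) = - (a * (norm (w - z0))\<^sup>2) + a * (norm (p - z0))\<^sup>2 + a * (norm (w - p))\<^sup>2"
        by blast
      moreover have "norm (g w) = norm (f w) * exp (- (2 * a * Re (cnj (p - z0) * (w - p))))"
        unfolding g_def norm_mult norm_exp_eq_Re by (simp add: algebra_simps)
      ultimately show ?thesis by (simp only: exp_add E_def mult.assoc)
    qed
    have inb: "w \<in> cball 0 r" if "norm (w - p) \<le> R" for w
      using True that norm_triangle_sub[of w p] by simp
    have "norm (g p) \<le> exp (- (a * R\<^sup>2)) / 2 * (G p * E * exp (a * R\<^sup>2)) + C * (A * E * exp (a * R\<^sup>2))"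
    proof (rule local[OF hol])
      show "\<forall>w. dist p w = R \<longrightarrow> norm (g w) \<le> G p * E * exp (a * R\<^sup>2)"
      proof (intro allI impI)
        fix w assume "dist p w = R"
        then have w: "norm (w - p) = R" by (simp add: dist_norm norm_minus_commute)
        have "G w * E * exp (a * (norm (w - p))\<^sup>2) \<le> G p * E * exp (a * R\<^sup>2)"
          unfolding w using p(2)[OF inb] w E by (intro mult_right_mono) auto
        then show "norm (g w) \<le> G p * E * exp (a * R\<^sup>2)"
          unfolding ng G_def .
      qed
      show "\<forall>w\<in>\<Lambda> \<inter> ball p R. norm (g w) \<le> A * E * exp (a * R\<^sup>2)"
      proof
        fix w assume w: "w \<in> \<Lambda> \<inter> ball p R"
        have "norm (f w) * exp (- (a * (norm (w - z0))\<^sup>2)) \<le> A"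
          using bound[of w] w by (simp add: exp_minus divide_simps)
        moreover have "norm (w - p) \<le> R" using w by (simp add: dist_norm norm_minus_commute)
        then have "exp (a * (norm (w - p))\<^sup>2) \<le> exp (a * R\<^sup>2)"
          using a by (simp add: power_mono)
        ultimately show "norm (g w) \<le> A * E * exp (a * R\<^sup>2)"
          unfolding ng using E A by (intro mult_mono) auto
      qed
      show "0 \<le> G p * E * exp (a * R\<^sup>2)" "0 \<le> A * E * exp (a * R\<^sup>2)"
        using E A by (auto simp: G_def)
    qed
    also have "exp (- (a * R\<^sup>2)) / 2 * (G p * E * exp (a * R\<^sup>2)) = G p * E / 2"
      by (simp add: exp_minus field_simps)
    also have "norm (g p) = G p * E" unfolding ng G_def by simp
    finally have "G p * E \<le> 2 * C * exp (a * R\<^sup>2) * A * E" by (simp add: algebra_simps)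
    then have "G p \<le> 2 * C * exp (a * R\<^sup>2) * A" using E by simp
    then show False using Gz neg by simp
  qed
qed

section \<open>Maximum modulus, type and density as real inequalities\<close>

lemma norm_le_max_modulus:
  assumes "f holomorphic_on UNIV" "norm z = r"
  shows "norm (f z) \<le> max_modulus f r"
proof -
  have "continuous_on (sphere 0 r) (\<lambda>z. norm (f z))"
    using assms(1) holomorphic_on_imp_continuous_on holomorphic_on_subset
    by (intro continuous_intros) blast
  then have "bdd_above ((\<lambda>z. norm (f z)) ` sphere 0 r)"
    by (intro bounded_imp_bdd_above compact_imp_bounded compact_continuous_image) auto
  then show ?thesis unfolding max_modulus_def using assms(2) by (intro cSUP_upper) auto
qed

lemma max_modulus_le:
  assumes "r \<ge> 0" "\<And>z. norm z = r \<Longrightarrow> norm (f z) \<le> B"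
  shows "max_modulus f r \<le> B"
  unfolding max_modulus_def
proof (rule cSUP_least)
  have "complex_of_real r \<in> sphere 0 r" using assms(1) by simp
  then show "sphere (0 :: complex) r \<noteq> {}" by blast
qed (use assms in auto)

lemma max_modulus_nonneg:
  assumes "f holomorphic_on UNIV" "r \<ge> 0"
  shows "0 \<le> max_modulus f r"
  using norm_le_max_modulus[OF assms(1), of "of_real r" r] assms(2) norm_ge_zero
  by (metis abs_of_nonneg norm_of_real order_trans)

lemma elog_divide_le:
  assumes "0 \<le> x" "x \<le> exp (y * h)" "h > 0"
  shows "elog x / ereal h \<le> ereal y"
proof (cases "x = 0")
  case True
  then show ?thesis using assms by (simp add: elog_def)
next
  case False
  then have "ln x \<le> y * h" using assms by (metis less_le ln_exp ln_mono)
  then show ?thesis using False assms by (simp add: elog_def field_simps)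
qed

lemma elog_divide_less_imp_le:
  assumes "0 \<le> x" "elog x / ereal h < ereal y" "h > 0"
  shows "x \<le> exp (y * h)"
proof (cases "x = 0")
  case False
  then have "ln x < y * h" using assms by (simp add: elog_def field_simps)
  then show ?thesis using assms False by (metis exp_le_cancel_iff exp_ln less_eq_real_def)
qed simp

text \<open>A single side length is enough, since \<open>disc_count_from_square_count\<close> passes
  from it to all large discs. Finiteness makes \<open>card\<close> agree with the counting
  measure.\<close>

lemma lower_Beurling_density_square_count:
  assumes D: "ereal D < lower_Beurling_density \<Lambda>" and fin: "\<And>z R. finite (\<Lambda> \<inter> ball z R)"
  shows "\<exists>r>0. \<forall>z. D * r\<^sup>2 \<le> card (\<Lambda> \<inter> (\<lambda>w. complex_of_real r * w + z) ` unit_square)"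
proof -
  define I where "I = (\<lambda>r z. enn2ereal (emeasure (count_space UNIV)
      (\<Lambda> \<inter> (\<lambda>w. complex_of_real r * w + z) ` unit_square)))"
  have "\<forall>\<^sub>F r in at_top. ereal D < (INF z. I r z) / ereal (r\<^sup>2)"
    using less_LiminfD D unfolding lower_Beurling_density_def I_def by blast
  then have "\<forall>\<^sub>F r in at_top. r > 0 \<and> ereal D < (INF z. I r z) / ereal (r\<^sup>2)"
    by (intro eventually_conj eventually_gt_at_top)
  then obtain r :: real where r: "r > 0" "ereal D < (INF z. I r z) / ereal (r\<^sup>2)"
    by (metis (no_types, lifting) eventually_happens trivial_limit_at_top_linorder)
  have "D * r\<^sup>2 \<le> card (\<Lambda> \<inter> (\<lambda>w. complex_of_real r * w + z) ` unit_square)" for z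
  proof -
    define Q where "Q = (\<lambda>w. complex_of_real r * w + z) ` unit_square"
    have "Q \<subseteq> ball 0 (r + norm z + 1)"
    proof
      fix x assume "x \<in> Q"
      then obtain w where w: "x = complex_of_real r * w + z" "w \<in> unit_square" by (auto simp: Q_def)
      have "norm w \<le> 1" using cmod_le[of w] w(2) by (simp add: unit_square_def)
      then have "r * norm w \<le> r" using r(1) by simp
      moreover have "norm x \<le> r * norm w + norm z"
        using norm_triangle_ineq[of "complex_of_real r * w" z] r(1) by (simp add: w norm_mult)
      ultimately show "x \<in> ball 0 (r + norm z + 1)" by simp
    qed
    then have finQ: "finite (\<Lambda> \<inter> Q)" using fin by (meson Int_mono finite_subset subset_refl)
    have "ereal (D * r\<^sup>2) < (INF z. I r z)"
      using r by (simp add: ereal_less_divide_pos mult.commute)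
    also have "\<dots> \<le> I r z" by (rule INF_lower) simp
    also have "\<dots> = ereal (card (\<Lambda> \<inter> Q))"
      using finQ unfolding I_def Q_def[symmetric]
      by (simp add: emeasure_count_space enn2ereal_of_nat flip: ennreal_of_nat_eq_real_of_nat)
    finally show ?thesis by (simp add: Q_def)
  qed
  then show ?thesis using r by blast
qed

lemma frequently_growth_bound:
  assumes f: "f holomorphic_on UNIV"
    and tau: "Liminf at_top (\<lambda>r::real. elog (max_modulus f r) / ereal (r\<^sup>2)) < ereal b"
  shows "\<exists>\<^sub>F r in at_top. \<forall>w. norm w = r \<longrightarrow> norm (f w) \<le> exp (b * r\<^sup>2)"
proof (rule ccontr)
  assume "\<not> ?thesis"
  then have "\<forall>\<^sub>F r in at_top. \<not> (\<forall>w. norm w = r \<longrightarrow> norm (f w) \<le> exp (b * r\<^sup>2))"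
    by (simp add: not_frequently)
  with eventually_gt_at_top[of 0] have "\<forall>\<^sub>F r::real in at_top. ereal b \<le> elog (max_modulus f r) / ereal (r\<^sup>2)"
  proof eventually_elim
    case (elim r)
    then obtain w where w: "norm w = r" "\<not> norm (f w) \<le> exp (b * r\<^sup>2)" by blast
    then have "\<not> max_modulus f r \<le> exp (b * r\<^sup>2)"
      using norm_le_max_modulus[OF f w(1)] by linarith
    then show ?case
      using elog_divide_less_imp_le[of "max_modulus f r" "r\<^sup>2" b] max_modulus_nonneg[OF f, of r] elim(1)
      by fastforce
  qed
  then show False using Liminf_bounded tau by fastforce
qed

section \<open>Growth comparison with \<open>H\<close>\<close>

theorem theorem4:
  fixes f :: "complex \<Rightarrow> complex"
    and lam :: "nat \<Rightarrow> complex"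
    and H :: "real \<Rightarrow> real"
    and \<tau> \<kappa> :: ereal
  assumes entire: "f holomorphic_on UNIV"
    and tau: "\<tau> = Liminf at_top (\<lambda>r::real. elog (max_modulus f r) / ereal (r\<^sup>2))"
    and tau_finite: "\<tau> < \<infinity>"
    and distinct: "inj lam"
    and discrete: "uniform_discrete (range lam)"
    and density: "lower_Beurling_density (range lam) > 2 * \<tau> / ereal pi"
    and H_pos: "\<And>r. r > 0 \<Longrightarrow> H r > 0"
    and H_mono: "mono_on {0<..} H"
    and H_unbounded: "\<not> bdd_above (H ` {0<..})"
    and H_quot_antimono: "antimono_on {0<..} (\<lambda>r. H r / r\<^sup>2)"
    and H_quot_lim: "((\<lambda>r. H r / r\<^sup>2) \<longlongrightarrow> 0) at_top"
    and kappa: "\<kappa> = Limsup sequentially (\<lambda>j. elog (norm (f (lam j))) / ereal (H (norm (lam j))))"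
    and kappa_finite: "\<kappa> < \<infinity>"
  shows "Limsup at_top (\<lambda>r::real. elog (max_modulus f r) / ereal (H r)) \<le> \<kappa>"
proof (cases "\<forall>z. f z = 0")
  case True
  have "\<forall>\<^sub>F r in at_top. elog (max_modulus f r) / ereal (H r) \<le> \<kappa>"
    using eventually_gt_at_top[of 0]
  proof eventually_elim
    case (elim r)
    \<comment> \<open>Here \<open>elog\<close> gives minus infinity, so the quotient lies below
      every \<open>\<kappa>\<close>, even an infinite one.\<close>
    have "max_modulus f r = 0"
      using max_modulus_le[of r f 0] max_modulus_nonneg[OF entire, of r] elim True by force
    then show ?case using H_pos[OF elim] by (simp add: elog_def)
  qed
  then show ?thesis by (rule Limsup_bounded)
next
  case False
  have H_lim: "filterlim H at_top at_top"
    unfolding filterlim_at_top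
  proof
    fix Z
    obtain x where x: "x > 0" "H x > Z"
      using H_unbounded unfolding bdd_above_def by (force simp: not_le)
    have "Z \<le> H r" if "r \<ge> x" for r
      using mono_onD[OF H_mono, of x r] x that by simp
    then show "\<forall>\<^sub>F r in at_top. Z \<le> H r" using eventually_at_top_linorder by blast
  qed
  \<comment> \<open>If \<open>\<tau>\<close> were negative, possibly minus infinity, the maximum of
    \<open>|f|\<close> would tend to 0 along a sequence of circles, and the maximum principle would
    give \<open>f = 0\<close>. Hence \<open>\<tau>\<close> is a real number
    \<open>t\<close>.\<close>
  have "0 \<le> \<tau>"
  proof (rule ccontr)
    assume "\<not> 0 \<le> \<tau>"
    then obtain c where c: "\<tau> < ereal c" "c < 0"
      using ereal_dense2[of \<tau> 0] by (auto simp: not_le)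
    obtain z where z: "f z \<noteq> 0" using False by blast
    have freq: "\<exists>\<^sub>F r in at_top. \<forall>w. norm w = r \<longrightarrow> norm (f w) \<le> exp (c * r\<^sup>2)"
      using frequently_growth_bound[OF entire] c(1) tau by simp
    have "filterlim (\<lambda>r::real. (- c) * r\<^sup>2) at_top at_top"
      using c by (intro filterlim_tendsto_pos_mult_at_top[OF tendsto_const]
          filterlim_pow_at_top filterlim_ident) auto
    then have "\<forall>\<^sub>F r::real in at_top. - ln (norm (f z)) < (- c) * r\<^sup>2"
      unfolding filterlim_at_top_dense by blast
    with eventually_gt_at_top[of "norm z"]
    have "\<forall>\<^sub>F r::real in at_top. norm z < r \<and> - ln (norm (f z)) < (- c) * r\<^sup>2"
      by eventually_elim simp
    from frequently_eventually_frequently[OF freq this]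
    obtain r where r: "\<And>w. norm w = r \<Longrightarrow> norm (f w) \<le> exp (c * r\<^sup>2)" "norm z < r"
      "c * r\<^sup>2 < ln (norm (f z))" by (auto dest!: frequently_ex)
    have "norm (f z) \<le> exp (c * r\<^sup>2)"
      using entire_max_sphere[OF entire r(1)] r(2) by simp
    also have "\<dots> < exp (ln (norm (f z)))" using r(3) by simp
    finally show False using z by simp
  qed
  then obtain t where t: "\<tau> = ereal t" "t \<ge> 0" using tau_finite by (cases \<tau>) auto
  define \<Lambda> where "\<Lambda> = range lam"
  have "ereal (2 * t / pi) < lower_Beurling_density \<Lambda>"
    using density by (simp add: t \<Lambda>_def)
  then obtain D1 where D1: "2 * t / pi < D1" "ereal D1 < lower_Beurling_density \<Lambda>"
    using ereal_dense2 by (metis ereal_less(4) less_ereal.simps(1))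
  \<comment> \<open>Room is needed on both sides: \<open>D < D1\<close> for the packing of squares,
    and \<open>2 * t / pi < D\<close> to fit \<open>t < b < a < D * pi / 2\<close>, with
    \<open>b\<close> for the growth on circles and \<open>a\<close> for the Gaussian weight.\<close>
  define D where "D = (2 * t / pi + D1) / 2"
  have D: "2 * t / pi < D" "D < D1" using D1 by (auto simp: D_def)
  have "0 \<le> 2 * t / pi" using t(2) by simp
  then have Dp: "D > 0" using D by linarith
  obtain \<delta> where \<delta>: "\<delta> > 0" and sep: "\<And>x y. x \<in> \<Lambda> \<Longrightarrow> y \<in> \<Lambda> \<Longrightarrow> dist x y < \<delta> \<Longrightarrow> x = y"
    using discrete unfolding \<Lambda>_def uniform_discrete_def by metis
  have fin: "finite (\<Lambda> \<inter> ball z R)" for z R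
    using uniformly_discrete_card_ball[OF \<delta> sep] by metis
  obtain r0 where r0: "r0 > 0"
    "\<And>z. D1 * r0\<^sup>2 \<le> card (\<Lambda> \<inter> (\<lambda>w. complex_of_real r0 * w + z) ` unit_square)"
    using lower_Beurling_density_square_count[OF D1(2) fin] by blast
  obtain t0 where t0: "t0 > 0" "\<And>s z. s \<ge> t0 \<Longrightarrow> D * pi * s\<^sup>2 \<le> card (\<Lambda> \<inter> cball z s)"
    using disc_count_from_square_count[OF fin Dp D(2) r0] by blast
  have tD: "t < D * pi / 2" using D(1) by (simp add: field_simps)
  define a where "a = (t + D * pi / 2) / 2"
  define b where "b = (t + a) / 2"
  have a: "t < b" "b < a" "a < D * pi / 2" "a > 0"
    using tD t(2) by (auto simp: a_def b_def)
  obtain R C where RC: "R > 0" "C \<ge> 0" and local: "\<And>z g M m. \<lbrakk>g holomorphic_on UNIV; \<forall>w. dist z w = R \<longrightarrow> norm (g w) \<le> M;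
        \<forall>w\<in>\<Lambda> \<inter> ball z R. norm (g w) \<le> m; 0 \<le> M; 0 \<le> m\<rbrakk> \<Longrightarrow>
        norm (g z :: complex) \<le> exp (- (a * R\<^sup>2)) / 2 * M + C * m"
  proof -
    have "\<exists>R>0. \<exists>C\<ge>0. \<forall>z g M m. g holomorphic_on UNIV \<longrightarrow> (\<forall>w. dist z w = R \<longrightarrow> norm (g w) \<le> M) \<longrightarrow>
       (\<forall>w\<in>\<Lambda> \<inter> ball z R. norm (g w) \<le> m) \<longrightarrow> 0 \<le> M \<longrightarrow> 0 \<le> m \<longrightarrow>
       norm (g z :: complex) \<le> exp (- (a * R\<^sup>2)) / 2 * M + C * m"
      by (rule sampling_estimate_local[OF \<delta> _ Dp t0(1) _ a(3)]) (fact sep t0(2))+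
    then show ?thesis using that by metis
  qed
  have growth: "\<exists>\<^sub>F r in at_top. \<forall>w. norm w = r \<longrightarrow> norm (f w) \<le> exp (b * r\<^sup>2)"
    by (rule frequently_growth_bound[OF entire]) (use a(1) in \<open>simp add: tau[symmetric] t(1)\<close>)
  define C1 where "C1 = 2 * C * exp (a * R\<^sup>2) + 1"
  have C1: "C1 \<ge> 1" using RC by (simp add: C1_def)
  have sampling: "norm (f z) \<le> C1 * A"
    if "A \<ge> 0" "\<And>x. x \<in> \<Lambda> \<Longrightarrow> norm (f x) \<le> A * exp (a * (norm (x - z))\<^sup>2)" for z A
  proof -
    have "norm (f z) \<le> 2 * C * exp (a * R\<^sup>2) * A"
      by (rule sampling_estimate_global[OF entire a(4) RC _ growth a(2) that(1)]) (fact local that(2))+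
    then show ?thesis using that(1) by (simp add: C1_def algebra_simps)
  qed
  have sample_bound: "\<exists>S. finite S \<and> S \<subseteq> \<Lambda> \<and> (\<forall>x\<in>\<Lambda> - S. x \<noteq> 0 \<and> norm (f x) \<le> exp (k * H (norm x)))"
    if k: "\<kappa> < ereal k" for k
  proof -
    have "\<forall>\<^sub>F j in sequentially. elog (norm (f (lam j))) / ereal (H (norm (lam j))) < ereal k"
      using Limsup_lessD k kappa by blast
    then obtain N where N: "\<And>j. j \<ge> N \<Longrightarrow> elog (norm (f (lam j))) / ereal (H (norm (lam j))) < ereal k"
      by (auto simp: eventually_sequentially)
    \<comment> \<open>The point 0 counts as exceptional because \<open>H\<close> is controlled on
      positive reals only.\<close>
    define S where "S = insert 0 (lam ` {..<N}) \<inter> \<Lambda>"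
    have "x \<noteq> 0 \<and> norm (f x) \<le> exp (k * H (norm x))" if x: "x \<in> \<Lambda> - S" for x
    proof -
      obtain j where j: "x = lam j" "j \<ge> N" "x \<noteq> 0"
        using x unfolding S_def \<Lambda>_def by (auto simp: not_less[symmetric])
      then show ?thesis using N[of j] elog_divide_less_imp_le[of "norm (f x)"] H_pos[of "norm x"] by simp
    qed
    then show ?thesis by (intro exI[of _ S]) (auto simp: S_def)
  qed
  \<comment> \<open>For negative \<open>\<kappa>\<close> the samples decay, \<open>sampling\<close>
    carries the decay over to \<open>f\<close>, and Liouville's theorem gives \<open>f = 0\<close>.
    The sign is needed below for \<open>k > 0\<close>.\<close>
  have "\<kappa> \<ge> 0"
  proof (rule ccontr)
    assume "\<not> 0 \<le> \<kappa>"
    then obtain k where k: "\<kappa> < ereal k" "k < 0"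
      using ereal_dense2[of \<kappa> 0] by (auto simp: not_le)
    obtain S where S: "finite S" "S \<subseteq> \<Lambda>" "\<And>x. x \<in> \<Lambda> - S \<Longrightarrow> x \<noteq> 0 \<and> norm (f x) \<le> exp (k * H (norm x))"
      using sample_bound[OF k(1)] by blast
    define F0 where "F0 = (\<Sum>x\<in>S. norm (f x))"
    define \<rho> where "\<rho> = (\<Sum>x\<in>S. norm x)"
    have F0: "F0 \<ge> 0" "\<And>x. x \<in> S \<Longrightarrow> norm (f x) \<le> F0"
      unfolding F0_def using S(1) by (auto intro!: sum_nonneg member_le_sum)
    have \<rho>: "\<And>x. x \<in> S \<Longrightarrow> norm x \<le> \<rho>"
      unfolding \<rho>_def using S(1) by (auto intro!: member_le_sum)
    \<comment> \<open>The summands serve, in this order, the points of \<open>S\<close>, which have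
      norm at most \<open>\<rho>\<close>; the points with \<open>norm x \<ge> norm z / 2\<close>,
      where \<open>H\<close> is monotone and \<open>k < 0\<close>; and the remaining ones, where
      \<open>norm (f x) \<le> 1\<close> and the distance to \<open>z\<close> is at least
      \<open>norm z / 2\<close>.\<close>
    define T where "T = (\<lambda>r. F0 * exp (- (a * (r - \<rho>)\<^sup>2)) + exp (k * H (r / 2)) + exp (- (a * (r / 2)\<^sup>2)))"
    have est: "norm (f z) \<le> C1 * T (norm z)" if z: "norm z > \<rho>" "norm z > 0" for z
    proof (rule sampling)
      have pos: "F0 * exp (- (a * (norm z - \<rho>)\<^sup>2)) \<ge> 0" using F0 by simp
      then show T0: "T (norm z) \<ge> 0" by (simp add: T_def add_nonneg_nonneg)
      fix x assume x: "x \<in> \<Lambda>"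
      have le: "norm (f x) \<le> T (norm z) * exp (a * (norm (x - z))\<^sup>2)"
        if "norm (f x) \<le> Y * exp (a * (norm (x - z))\<^sup>2)" "Y \<le> T (norm z)" for Y
        using that by (meson exp_ge_zero mult_right_mono order_trans)
      show "norm (f x) \<le> T (norm z) * exp (a * (norm (x - z))\<^sup>2)"
      proof (cases "x \<in> S")
        case True
        have "norm z - \<rho> \<le> norm (x - z)" using \<rho>[OF True] norm_triangle_ineq3[of x z] by linarith
        then have "(norm z - \<rho>)\<^sup>2 \<le> (norm (x - z))\<^sup>2" using z by (intro power_mono) auto
        then have "1 \<le> exp (- (a * (norm z - \<rho>)\<^sup>2)) * exp (a * (norm (x - z))\<^sup>2)"
          using a(4) by (simp add: exp_add[symmetric])
        then have "F0 * 1 \<le> F0 * (exp (- (a * (norm z - \<rho>)\<^sup>2)) * exp (a * (norm (x - z))\<^sup>2))"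
          using F0(1) by (rule mult_left_mono)
        then show ?thesis using F0(2)[OF True]
          by (intro le[of "F0 * exp (- (a * (norm z - \<rho>)\<^sup>2))"]) (auto simp: T_def add_nonneg_nonneg)
      next
        case False
        then have x0: "x \<noteq> 0" "norm (f x) \<le> exp (k * H (norm x))" using S(3) x by auto
        show ?thesis
        proof (cases "norm x \<ge> norm z / 2")
          case True
          then have "H (norm z / 2) \<le> H (norm x)" using mono_onD[OF H_mono] z x0 by simp
          then have "norm (f x) \<le> exp (k * H (norm z / 2))"
            using x0 k(2) by (meson exp_le_cancel_iff mult_left_mono_neg order_less_imp_le order_trans)
          moreover have "1 \<le> exp (a * (norm (x - z))\<^sup>2)" using a(4) by simp
          ultimately have "norm (f x) * 1 \<le> exp (k * H (norm z / 2)) * exp (a * (norm (x - z))\<^sup>2)"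
            by (intro mult_mono) auto
          then show ?thesis using pos by (intro le[of "exp (k * H (norm z / 2))"]) (auto simp: T_def)
        next
          case False
          have "norm z / 2 \<le> norm (x - z)" using False norm_triangle_ineq3[of x z] by linarith
          then have "(norm z / 2)\<^sup>2 \<le> (norm (x - z))\<^sup>2" by (intro power_mono) auto
          then have "1 \<le> exp (- (a * (norm z / 2)\<^sup>2)) * exp (a * (norm (x - z))\<^sup>2)"
            using a(4) unfolding exp_add[symmetric] by simp
          moreover have "k * H (norm x) \<le> 0" using k H_pos[of "norm x"] x0 by (simp add: mult_nonpos_nonneg)
          then have "norm (f x) \<le> 1" using x0(2) by (meson exp_le_one_iff order_trans)
          ultimately have "norm (f x) \<le> exp (- (a * (norm z / 2)\<^sup>2)) * exp (a * (norm (x - z))\<^sup>2)"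
            by linarith
          then show ?thesis using pos by (intro le[of "exp (- (a * (norm z / 2)\<^sup>2))"]) (auto simp: T_def)
        qed
      qed
    qed
    have half: "filterlim (\<lambda>r::real. r / 2) at_top at_top"
      using filterlim_tendsto_pos_mult_at_top[OF tendsto_const, of "1/2", OF _ filterlim_ident] by simp
    have exp_neg: "((\<lambda>r. exp (- (h r))) \<longlongrightarrow> 0) at_top" if "filterlim h at_top at_top" for h :: "real \<Rightarrow> real"
      by (rule filterlim_compose[OF exp_at_bot]) (use that in \<open>simp add: filterlim_uminus_at_bot\<close>)
    have sq: "filterlim (\<lambda>r. a * (h r)\<^sup>2) at_top at_top" if "filterlim h at_top at_top" for h :: "real \<Rightarrow> real"
      using a(4) that by (intro filterlim_tendsto_pos_mult_at_top[OF tendsto_const] filterlim_pow_at_top) auto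
    have "filterlim (\<lambda>r. (- k) * H (r / 2)) at_top at_top"
      using k(2) by (intro filterlim_tendsto_pos_mult_at_top[OF tendsto_const] filterlim_compose[OF H_lim half]) auto
    from exp_neg[OF this] have t2: "((\<lambda>r. exp (k * H (r / 2))) \<longlongrightarrow> 0) at_top" by simp
    have "filterlim (\<lambda>r::real. - \<rho> + r) at_top at_top"
      by (intro filterlim_tendsto_add_at_top[OF tendsto_const] filterlim_ident)
    then have sh: "filterlim (\<lambda>r::real. r - \<rho>) at_top at_top" by simp
    have "((\<lambda>r. C1 * T r) \<longlongrightarrow> C1 * (F0 * 0 + 0 + 0)) at_top"
      unfolding T_def by (intro tendsto_intros exp_neg sq half sh t2)
    then have "((\<lambda>z::complex. C1 * T (norm z)) \<longlongrightarrow> 0) at_infinity"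
      using filterlim_compose[OF _ filterlim_norm_at_top] by force
    moreover have "\<forall>\<^sub>F z in at_infinity. norm (f z) \<le> C1 * T (norm z)"
      using filterlim_norm_at_top[unfolded filterlim_at_top_dense, rule_format, of \<rho>]
        filterlim_norm_at_top[unfolded filterlim_at_top_dense, rule_format, of 0]
      by eventually_elim (rule est)
    ultimately have "(f \<longlongrightarrow> 0) at_infinity" by (rule Lim_null_comparison[rotated])
    then show False using Liouville_weak_0[OF entire] False by blast
  qed
  show ?thesis
    unfolding Limsup_le_iff
  proof (intro allI impI)
    fix y assume "\<kappa> < y"
    then obtain y' where y': "\<kappa> < ereal y'" "ereal y' < y" using ereal_dense2 by blast
    then obtain k where k: "\<kappa> < ereal k" "k < y'" using ereal_dense2 by (metis less_ereal.simps(1))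
    have kp: "k > 0" using \<open>\<kappa> \<ge> 0\<close> k(1) by (metis ereal_less(2) le_less_trans)
    obtain S where S: "finite S" "S \<subseteq> \<Lambda>" "\<And>x. x \<in> \<Lambda> - S \<Longrightarrow> x \<noteq> 0 \<and> norm (f x) \<le> exp (k * H (norm x))"
      using sample_bound[OF k(1)] by blast
    \<comment> \<open>Adding 1 keeps \<open>F0\<close> positive, as \<open>exp (ln F0) = F0\<close>
      requires, even if \<open>f\<close> vanishes on \<open>S\<close>.\<close>
    define F0 where "F0 = (\<Sum>x\<in>S. norm (f x)) + 1"
    have "(\<Sum>x\<in>S. norm (f x)) \<ge> 0" by (simp add: sum_nonneg)
    moreover have "norm (f x) \<le> (\<Sum>x\<in>S. norm (f x))" if "x \<in> S" for x
      using S(1) that by (intro member_le_sum) auto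
    ultimately have F0: "F0 \<ge> 1" "\<And>x. x \<in> S \<Longrightarrow> norm (f x) \<le> F0"
      unfolding F0_def by (auto intro: add_increasing2)
    \<comment> \<open>The gap \<open>y' - k\<close> is halved: one \<open>\<eta>\<close> pays for
      completing the square, the other for the constant \<open>C1\<close>.\<close>
    define \<eta> where "\<eta> = (y' - k) / 2"
    have \<eta>: "\<eta> > 0" using k by (simp add: \<eta>_def)
    \<comment> \<open>All four conditions hold for large \<open>r\<close>: \<open>h1\<close> and
      \<open>h2\<close> control the quadratic and the cross term in \<open>s\<close>,
      \<open>HF\<close> covers the exceptional points, and \<open>HC\<close> absorbs
      \<open>C1\<close>.\<close>
    have key: "norm (f z) \<le> exp (y' * H r)"
      if z: "norm z = r" "r > 0" and h1: "H r / r\<^sup>2 < a / (2 * k)" and h2: "H r / r\<^sup>2 < \<eta> * a / (2 * k\<^sup>2)"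
        and HF: "H r \<ge> ln F0 / (k + \<eta>)" and HC: "H r \<ge> ln C1 / \<eta>" for z r
    proof -
      define h where "h = H r / r\<^sup>2"
      have h: "h > 0" "H r = h * r\<^sup>2" using H_pos[OF z(2)] z(2) by (auto simp: h_def)
      have "norm (f z) \<le> C1 * exp ((k + \<eta>) * H r)"
      proof (rule sampling)
        fix x assume x: "x \<in> \<Lambda>"
        define s where "s = norm (x - z)"
        have s: "s \<ge> 0" by (simp add: s_def)
        show "norm (f x) \<le> exp ((k + \<eta>) * H r) * exp (a * (norm (x - z))\<^sup>2)"
        proof (cases "x \<in> S")
          case True
          have "ln F0 \<le> (k + \<eta>) * H r" using HF kp \<eta> by (simp add: field_simps)
          then have "F0 \<le> exp ((k + \<eta>) * H r)" using F0(1) by (metis exp_le_cancel_iff exp_ln less_le_trans zero_less_one)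
          then have "norm (f x) * 1 \<le> exp ((k + \<eta>) * H r) * exp (a * (norm (x - z))\<^sup>2)"
            using F0(2)[OF True] a(4) by (intro mult_mono) auto
          then show ?thesis by simp
        next
          case False
          then have x0: "x \<noteq> 0" "norm (f x) \<le> exp (k * H (norm x))" using S(3) x by auto
          have "norm x \<le> r + s" using norm_triangle_sub[of x z] z by (simp add: s_def)
          then have "H (norm x) \<le> H (r + s)" using mono_onD[OF H_mono] x0 z s by simp
          \<comment> \<open>The quotient \<open>H r / r^2\<close> does not increase from
            \<open>r\<close> to \<open>r + s\<close>.\<close>
          also have "H (r + s) \<le> h * (r + s)\<^sup>2"
            using monotone_onD[OF H_quot_antimono, of r "r + s"] z s
            by (simp add: h_def pos_divide_le_eq)
          finally have "k * H (norm x) \<le> k * (h * (r + s)\<^sup>2)" using kp by simp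
          also have "\<dots> = k * H r + 2 * k * h * r * s + (k * h) * s\<^sup>2"
            unfolding h(2) by (simp add: power2_eq_square algebra_simps)
          \<comment> \<open>The weight \<open>a s^2\<close> is split into halves. One dominates
            \<open>k h s^2\<close> by \<open>h1\<close>; the other comes from
            \<open>2 u v <= u^2 + v^2\<close> with \<open>u = 2 k h r\<close> and
            \<open>v = a s\<close>, divided by \<open>2 a\<close>. What remains is
            \<open>2 k^2 h / a\<close> times \<open>H r\<close>, at most \<open>\<eta> * H r\<close>
            by \<open>h2\<close>.\<close>
          also have "\<dots> \<le> k * H r + (2 * k\<^sup>2 * h / a * H r + a / 2 * s\<^sup>2) + a / 2 * s\<^sup>2"
          proof (intro add_mono order_refl mult_right_mono)
            have "(2 * k\<^sup>2 * h / a * H r + a / 2 * s\<^sup>2) * (2 * a) = (2 * k * h * r)\<^sup>2 + (a * s)\<^sup>2"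
              unfolding h(2) using a(4) by (simp add: power2_eq_square field_simps)
            moreover have "2 * (2 * k * h * r) * (a * s) \<le> (2 * k * h * r)\<^sup>2 + (a * s)\<^sup>2"
              by (rule sum_squares_bound)
            ultimately have "2 * k * h * r * s * (2 * a) \<le> (2 * k\<^sup>2 * h / a * H r + a / 2 * s\<^sup>2) * (2 * a)"
              by (simp add: mult_ac)
            then show "2 * k * h * r * s \<le> 2 * k\<^sup>2 * h / a * H r + a / 2 * s\<^sup>2"
              using a(4) by (simp only: mult_le_cancel_right)
            show "k * h \<le> a / 2" using h1 kp unfolding h_def[symmetric] by (simp add: field_simps)
          qed simp
          also have "\<dots> \<le> k * H r + (\<eta> * H r + a / 2 * s\<^sup>2) + a / 2 * s\<^sup>2"
          proof (intro add_mono order_refl mult_right_mono)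
            show "2 * k\<^sup>2 * h / a \<le> \<eta>" using h2 kp a(4) unfolding h_def[symmetric] by (simp add: field_simps)
          qed (use H_pos[OF z(2)] in simp)
          also have "\<dots> = (k + \<eta>) * H r + a * (norm (x - z))\<^sup>2" by (simp add: s_def algebra_simps)
          finally have "exp (k * H (norm x)) \<le> exp ((k + \<eta>) * H r) * exp (a * (norm (x - z))\<^sup>2)"
            unfolding exp_add[symmetric] by simp
          then show ?thesis using x0(2) by linarith
        qed
      qed simp
      also have "\<dots> \<le> exp (\<eta> * H r) * exp ((k + \<eta>) * H r)"
      proof (rule mult_right_mono)
        have "ln C1 \<le> \<eta> * H r" using HC \<eta> by (simp add: field_simps)
        then show "C1 \<le> exp (\<eta> * H r)" using C1 by (metis exp_le_cancel_iff exp_ln less_le_trans zero_less_one)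
      qed simp
      also have "\<dots> = exp (y' * H r)"
        unfolding exp_add[symmetric] by (simp add: \<eta>_def field_simps)
      finally show ?thesis .
    qed
    have "0 < a / (2 * k)" "0 < \<eta> * a / (2 * k\<^sup>2)" using kp a(4) \<eta> by auto
    from order_tendstoD(2)[OF H_quot_lim this(1)] order_tendstoD(2)[OF H_quot_lim this(2)]
      H_lim[unfolded filterlim_at_top, rule_format, of "ln F0 / (k + \<eta>)"]
      H_lim[unfolded filterlim_at_top, rule_format, of "ln C1 / \<eta>"] eventually_gt_at_top[of "0::real"]
    show "\<forall>\<^sub>F r in at_top. elog (max_modulus f r) / ereal (H r) < y"
    proof eventually_elim
      case (elim r)
      have "max_modulus f r \<le> exp (y' * H r)"
        using elim key by (intro max_modulus_le) auto
      then have "elog (max_modulus f r) / ereal (H r) \<le> ereal y'"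
        using elim by (intro elog_divide_le max_modulus_nonneg[OF entire] H_pos) auto
      then show ?case using y'(2) by simp
    qed
  qed
qed

end
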